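(* Let $0<\alpha<\beta<\infty$, $\delta>0$, $0<r_-<r_+<\infty$, let $M\ge1$ be an integer, and let $\mathfrak M=\{1\leq m\leq M:(2m-1)\delta\leq\beta-\alpha\}$ (integers $m$). Assume $\mathfrak M\neq\varnothing$. For distinct $m,\ell\in\mathfrak M$, \[ \operatorname{dist}_{C([r_-,r_+])}\left(\mathcal G_m(\Theta_{m,\alpha,\beta,\delta}),\mathcal G_\ell(\Theta_{\ell,\alpha,\beta,\delta})\right)>0 . \] Moreover, there exist constants $\varepsilon,C>0$, depending only on $M,\alpha,\beta,\delta,r_-$ and $r_+$, such that whenever $m,\ell\in\mathfrak M$, $\vartheta\in\Theta_{m,\alpha,\beta,\delta}$ and $\widetilde\vartheta\in\Theta_{\ell,\alpha,\beta,\delta}$ satisfy \[ \left\|\mathcal G_m(\vartheta)-\mathcal G_\ell(\widetilde\vartheta)\right\|_{C([r_-,r_+])}<\varepsilon, \] one has $m=\ell$ and \[ \|\vartheta-\widetilde\vartheta\|_{\mathbb R^{2m}}\leq C\left\|\mathcal G_m(\vartheta)-\mathcal G_m(\widetilde\vartheta)\right\|_{C([r_-,r_+])} . \] In particular, $G_{\mu_\vartheta}\big|_{[r_-,r_+]}$ determines the number of intervals and all endpoints for $\vartheta$ ranging over the disjoint union $\Theta_{\leq M}=\bigsqcup_{m\in\mathfrak M}\Theta_{m,\alpha,\beta,\delta}$.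
   Context: For a finite positive measure $\mu$ supported in a compact subset of $(0,\infty)$, $G_\mu(r)=\int_0^\infty\int_0^\infty\frac{\mu(\mathrm dy)\,\mu(\mathrm dv)}{(r^2+(y+v)^2)^2}$ for $r>0$. For $\vartheta=(a_1,b_1,\ldots,a_m,b_m)\in\mathbb R^{2m}$ with $0<a_1<b_1<\cdots<a_m<b_m<\infty$, put $I(\vartheta)=\bigcup_{j=1}^m[a_j,b_j]$ and $\mu_\vartheta(\mathrm dy)=\mathbf 1_{I(\vartheta)}(y)\,\mathrm dy$. The class $\Theta_{m,\alpha,\beta,\delta}$ consists of all such $\vartheta$ with $\alpha\leq a_1$, $b_m\leq\beta$, $b_j-a_j\geq\delta$ for $1\leq j\leq m$, and $a_{j+1}-b_j\geq\delta$ for $1\leq j<m$. $C([r_-,r_+])$ carries the supremum norm, $\mathcal G_m:\Theta_{m,\alpha,\beta,\delta}\to C([r_-,r_+])$ is $\mathcal G_m(\vartheta)=G_{\mu_\vartheta}|_{[r_-,r_+]}$, $\|\cdot\|_{\mathbb R^{2m}}$ is the Euclidean norm, and $\operatorname{dist}(A,B)=\inf_{f\in A,g\in B}\|f-g\|$. *)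

theory Defs
  imports "HOL-Analysis.Analysis"
begin

definition G :: "real measure \<Rightarrow> real \<Rightarrow> real" where
  "G \<mu> r = (LINT y:{0<..}|\<mu>. LINT v:{0<..}|\<mu>. 1 / (r\<^sup>2 + (y + v)\<^sup>2)\<^sup>2)"

text \<open>
  A vector \<open>(a\<^sub>1, b\<^sub>1, \<dots>, a\<^sub>m, b\<^sub>m)\<close> of \<open>\<real>\<^bsup>2m\<^esup>\<close> is a real list of length \<open>2 * m\<close>.
  Intervals are counted from 0, so that \<open>left_end \<theta> j\<close> is \<open>a\<^bsub>j+1\<^esub>\<close> and \<open>right_end \<theta> j\<close> is
  \<open>b\<^bsub>j+1\<^esub>\<close>.
\<close>

definition left_end :: "real list \<Rightarrow> nat \<Rightarrow> real" where
  "left_end \<theta> j = \<theta> ! (2 * j)"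

definition right_end :: "real list \<Rightarrow> nat \<Rightarrow> real" where
  "right_end \<theta> j = \<theta> ! (2 * j + 1)"

definition I_set :: "nat \<Rightarrow> real list \<Rightarrow> real set" where
  "I_set m \<theta> = (\<Union>j<m. {left_end \<theta> j..right_end \<theta> j})"

definition mu :: "nat \<Rightarrow> real list \<Rightarrow> real measure" where
  "mu m \<theta> = density lborel (indicator (I_set m \<theta>))"

text \<open>
  The condition \<open>sorted_wrt (<) (0 # \<theta>)\<close> is the chain \<open>0 < a\<^sub>1 < b\<^sub>1 < \<dots> < a\<^sub>m < b\<^sub>m\<close>.
  The definition is meant for \<open>m \<ge> 1\<close>.
\<close>

definition Theta :: "nat \<Rightarrow> real \<Rightarrow> real \<Rightarrow> real \<Rightarrow> real list set" where
  "Theta m \<alpha> \<beta> \<delta> = {\<theta>. length \<theta> = 2 * m \<and> sorted_wrt (<) (0 # \<theta>) \<and>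
     \<alpha> \<le> left_end \<theta> 0 \<and> right_end \<theta> (m - 1) \<le> \<beta> \<and>
     (\<forall>j<m. right_end \<theta> j - left_end \<theta> j \<ge> \<delta>) \<and>
     (\<forall>j. Suc j < m \<longrightarrow> left_end \<theta> (Suc j) - right_end \<theta> j \<ge> \<delta>)}"

text \<open>The Euclidean distance \<open>\<parallel>\<theta> - \<theta>'\<parallel>\<close> in \<open>\<real>\<^bsup>n\<^esup>\<close>.\<close>

definition euclid_dist :: "nat \<Rightarrow> real list \<Rightarrow> real list \<Rightarrow> real" where
  "euclid_dist n \<theta> \<theta>' = L2_set (\<lambda>i. \<theta> ! i - \<theta>' ! i) {..<n}"

text \<open>
  \<open>C([r\<^sub>-, r\<^sub>+])\<close> with the metric of the supremum norm: \<open>mdist (C_space rm rp) f g\<close> is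
  \<open>\<parallel>f - g\<parallel>\<close>. The points of \<^const>\<open>cfunspace\<close> are extensional functions, hence the
  \<^const>\<open>restrict\<close> in \<open>G_map\<close>, which also makes equality of values of \<open>G_map\<close> mean equality
  on \<open>[r\<^sub>-, r\<^sub>+]\<close> only.
\<close>

abbreviation C_space :: "real \<Rightarrow> real \<Rightarrow> (real \<Rightarrow> real) metric" where
  "C_space rm rp \<equiv> cfunspace (top_of_set {rm..rp}) euclidean_metric"

definition G_map :: "real \<Rightarrow> real \<Rightarrow> nat \<Rightarrow> real list \<Rightarrow> real \<Rightarrow> real" where
  "G_map rm rp m \<theta> = restrict (G (mu m \<theta>)) {rm..rp}"

definition set_mdist :: "'a metric \<Rightarrow> 'a set \<Rightarrow> 'a set \<Rightarrow> real" where
  "set_mdist X A B = (INF (f, g)\<in>A \<times> B. mdist X f g)"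

definition admissible :: "nat \<Rightarrow> real \<Rightarrow> real \<Rightarrow> real \<Rightarrow> nat set" where
  "admissible M \<alpha> \<beta> \<delta> = {m. 1 \<le> m \<and> m \<le> M \<and> (2 * real m - 1) * \<delta> \<le> \<beta> - \<alpha>}"

end

theory Submission
  imports Defs "HOL-Computational_Algebra.Polynomial"
begin

text \<open>
  Since \<open>K2 r s = s * arctan (s / r) / (2 * r ^ 3)\<close> satisfies \<open>\<partial>\<^sub>s\<^sup>2 K2 r s = 1 / (r\<^sup>2 + s\<^sup>2)\<^sup>2\<close>, integrating over
  the intervals gives the finite sum \<open>G r = (\<Sum>i j. \<epsilon>\<^sub>i * \<epsilon>\<^sub>j * K2 r (x\<^sub>i + x\<^sub>j))\<close> over all endpoints,
  with sign \<open>+\<close> for right and \<open>-\<close> for left endpoints. Differentiating in \<open>r\<close> turns \<open>r ^ 3 * K2 r s\<close>, for distinct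
  \<open>s > 0\<close>, into rational functions of \<open>r\<^sup>2\<close> with distinct poles, so these functions are linearly
  independent on every interval. Hence a relation between such sums persists when \<open>K2 r\<close> is replaced by any
  function, in particular by \<open>s \<mapsto> exp (t * s)\<close>, for which the double sum is the square of
  \<open>\<Sum>i. \<epsilon>\<^sub>i * exp (t * x\<^sub>i) > 0\<close>. So \<open>G\<close> determines this exponential sum, hence the endpoints. The same argument
  with \<open>\<partial>\<^sub>s K2\<close> shows that the derivative of \<open>\<theta> \<mapsto> G\<close> is injective: there the double sum factors into the
  positive exponential sum and \<open>\<Sum>i. \<epsilon>\<^sub>i * h\<^sub>i * exp (t * x\<^sub>i)\<close>. Compactness of the parameter sets turns injectivity
  into separation and injectivity of the derivative into the Lipschitz bound.
\<close>

section \<open>Linear independence\<close>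

text \<open>Clearing denominators leaves a polynomial in \<open>r\<^sup>2\<close> with infinitely
  many roots, and the poles \<open>- s\<^sup>2\<close> are distinct because all \<open>s\<close> are
  positive. The exponent \<open>k\<close> is general since \<open>K2\<close> leads to simple poles
  and \<open>K1\<close> to double ones.\<close>

lemma partial_fractions_independent:
  fixes S :: "real set" and d :: "real \<Rightarrow> real"
  assumes S: "finite S" "\<And>s. s \<in> S \<Longrightarrow> 0 < s" and "0 \<le> a" "a < b" "0 < k"
    and zero: "\<And>r. a < r \<Longrightarrow> r < b \<Longrightarrow> (\<Sum>s\<in>S. d s / (r\<^sup>2 + s\<^sup>2) ^ k) = 0"
    and "s \<in> S"
  shows "d s = 0"
proof -
  define P where "P = (\<Sum>s\<in>S. smult (d s) (\<Prod>u\<in>S - {s}. [:u\<^sup>2, 1:] ^ k))"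
  have poly_P: "poly P z = (\<Sum>s\<in>S. d s * (\<Prod>u\<in>S - {s}. (u\<^sup>2 + z) ^ k))" for z
    by (simp add: P_def poly_sum poly_prod)
  have root: "poly P (r\<^sup>2) = 0" if "a < r" "r < b" for r
  proof -
    have "d s * (\<Prod>u\<in>S - {s}. (u\<^sup>2 + r\<^sup>2) ^ k)
        = (\<Prod>u\<in>S. (u\<^sup>2 + r\<^sup>2) ^ k) * (d s / (r\<^sup>2 + s\<^sup>2) ^ k)" if "s \<in> S" for s
    proof -
      have "s\<^sup>2 + r\<^sup>2 \<noteq> 0"
        using S(2)[OF that] by (simp add: sum_power2_eq_zero_iff)
      then have "d s = (s\<^sup>2 + r\<^sup>2) ^ k * (d s / (s\<^sup>2 + r\<^sup>2) ^ k)"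
        by (subst times_divide_eq_right, subst nonzero_mult_div_cancel_left) auto
      then have "d s * (\<Prod>u\<in>S - {s}. (u\<^sup>2 + r\<^sup>2) ^ k)
          = (s\<^sup>2 + r\<^sup>2) ^ k * (d s / (s\<^sup>2 + r\<^sup>2) ^ k) * (\<Prod>u\<in>S - {s}. (u\<^sup>2 + r\<^sup>2) ^ k)"
        by (rule arg_cong)
      also have "\<dots> = (s\<^sup>2 + r\<^sup>2) ^ k * (\<Prod>u\<in>S - {s}. (u\<^sup>2 + r\<^sup>2) ^ k) * (d s / (s\<^sup>2 + r\<^sup>2) ^ k)"
        by (simp only: mult_ac)
      also have "(s\<^sup>2 + r\<^sup>2) ^ k * (\<Prod>u\<in>S - {s}. (u\<^sup>2 + r\<^sup>2) ^ k) = (\<Prod>u\<in>S. (u\<^sup>2 + r\<^sup>2) ^ k)"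
        by (rule prod.remove[OF S(1) that, symmetric])
      finally show ?thesis
        by (simp only: add.commute)
    qed
    then have "poly P (r\<^sup>2) = (\<Prod>u\<in>S. (u\<^sup>2 + r\<^sup>2) ^ k) * (\<Sum>s\<in>S. d s / (r\<^sup>2 + s\<^sup>2) ^ k)"
      unfolding poly_P sum_distrib_left by (rule sum.cong[OF refl])
    then show ?thesis
      using zero[OF that] by simp
  qed
  \<comment> \<open>Squaring is injective on nonnegative reals, so the interval yields infinitely
    many roots.\<close>
  have "infinite ((\<lambda>r. r\<^sup>2) ` {a<..<b})"
    using \<open>0 \<le> a\<close> \<open>a < b\<close> by (subst finite_image_iff) (auto intro!: inj_onI)
  moreover have "(\<lambda>r. r\<^sup>2) ` {a<..<b} \<subseteq> {z. poly P z = 0}"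
    using root by auto
  ultimately have "P = 0"
    using poly_roots_finite finite_subset by blast
  \<comment> \<open>Evaluating at the pole \<open>z = - s\<^sup>2\<close> isolates the coefficient \<open>d s\<close>.\<close>
  then have "0 = (\<Sum>t\<in>S. d t * (\<Prod>u\<in>S - {t}. (u\<^sup>2 + - s\<^sup>2) ^ k))"
    using poly_P[of "- s\<^sup>2"] by simp
  also have "\<dots> = d s * (\<Prod>u\<in>S - {s}. (u\<^sup>2 + - s\<^sup>2) ^ k)
      + (\<Sum>t\<in>S - {s}. d t * (\<Prod>u\<in>S - {t}. (u\<^sup>2 + - s\<^sup>2) ^ k))"
    using S(1) \<open>s \<in> S\<close> by (rule sum.remove)
  finally have *: "0 = d s * (\<Prod>u\<in>S - {s}. (u\<^sup>2 + - s\<^sup>2) ^ k)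
      + (\<Sum>t\<in>S - {s}. d t * (\<Prod>u\<in>S - {t}. (u\<^sup>2 + - s\<^sup>2) ^ k))" .
  have "(\<Prod>u\<in>S - {t}. (u\<^sup>2 + - s\<^sup>2) ^ k) = 0" if "t \<in> S - {s}" for t
    using S(1) \<open>s \<in> S\<close> that \<open>0 < k\<close> by (intro prod_zero) (auto intro!: bexI[of _ s])
  then have "d s * (\<Prod>u\<in>S - {s}. (u\<^sup>2 + - s\<^sup>2) ^ k) = 0"
    using * by simp
  moreover have "(\<Prod>u\<in>S - {s}. (u\<^sup>2 + - s\<^sup>2) ^ k) \<noteq> 0"
    using S \<open>s \<in> S\<close> by (auto simp: power2_eq_iff) (metis S(2) less_asym neg_0_less_iff_less)
  ultimately show ?thesis
    by simp
qed

text \<open>The factors are powers of the distinct numbers \<open>exp x\<close>, so this is a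
  Vandermonde argument. Exponents start at 1 because the endpoint sums are shown to be positive for
  \<open>t > 0\<close>.\<close>

lemma exponentials_independent:
  fixes E :: "real set" and d :: "real \<Rightarrow> real"
  assumes E: "finite E"
    and zero: "\<And>n. (\<Sum>x\<in>E. d x * exp (real (Suc n) * x)) = 0"
    and "x \<in> E"
  shows "d x = 0"
proof -
  \<comment> \<open>Combining the hypotheses with the coefficients of \<open>p\<close> annihilates every term but that of \<open>x\<close>.\<close>
  define p :: "real poly" where "p = (\<Prod>u\<in>E - {x}. [:- exp u, 1:])"
  have "(\<Sum>u\<in>E. d u * exp u * poly p (exp u))
      = (\<Sum>i\<le>degree p. coeff p i * (\<Sum>u\<in>E. d u * exp (real (Suc i) * u)))"
    unfolding poly_altdef sum_distrib_left
    by (subst sum.swap)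
      (auto intro!: sum.cong simp: exp_add exp_of_nat_mult[symmetric] algebra_simps)
  then have "0 = (\<Sum>u\<in>E. d u * exp u * poly p (exp u))"
    using zero by simp
  also have "\<dots> = d x * exp x * poly p (exp x) + (\<Sum>u\<in>E - {x}. d u * exp u * poly p (exp u))"
    using E \<open>x \<in> E\<close> by (rule sum.remove)
  also have "(\<Sum>u\<in>E - {x}. d u * exp u * poly p (exp u)) = 0"
    using E by (intro sum.neutral) (auto simp: p_def poly_prod)
  finally have "d x * exp x * poly p (exp x) = 0"
    by simp
  moreover have "poly p (exp x) \<noteq> 0"
    using E by (auto simp: p_def poly_prod)
  ultimately show ?thesis
    by simp
qed

section \<open>Antiderivatives of the kernel\<close>

text \<open>
  \<open>K1 r\<close> and \<open>K2 r\<close> are the first and second antiderivatives of \<open>s \<mapsto> 1 / (r\<^sup>2 + s\<^sup>2)\<^sup>2\<close>. They turn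
  \<open>G\<close> into a finite sum over pairs of endpoints.
\<close>

definition K2 :: "real \<Rightarrow> real \<Rightarrow> real" where
  "K2 r s = s * arctan (s / r) / (2 * r ^ 3)"

definition K1 :: "real \<Rightarrow> real \<Rightarrow> real" where
  "K1 r s = (arctan (s / r) + r * s / (r\<^sup>2 + s\<^sup>2)) / (2 * r ^ 3)"

lemma sum_power2_nonzero: "0 < (r::real) \<Longrightarrow> r\<^sup>2 + s\<^sup>2 \<noteq> 0"
  by (simp add: sum_power2_eq_zero_iff)

lemma K2_deriv: "0 < r \<Longrightarrow> (K2 r has_real_derivative K1 r s) (at s)"
  unfolding K2_def[abs_def] K1_def using sum_power2_nonzero[of r s]
  by (auto intro!: derivative_eq_intros simp: divide_simps) (simp add: algebra_simps power2_eq_square eval_nat_numeral)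

lemma K1_deriv: "0 < r \<Longrightarrow> (K1 r has_real_derivative 1 / (r\<^sup>2 + s\<^sup>2)\<^sup>2) (at s)"
  unfolding K1_def[abs_def] using sum_power2_nonzero[of r s]
  by (auto intro!: derivative_eq_intros simp: divide_simps) (simp add: algebra_simps power2_eq_square eval_nat_numeral)

text \<open>Multiplying by \<open>2 * r ^ 3\<close> leaves \<open>s * arctan (s / r)\<close>, whose
  \<open>r\<close>-derivative \<open>- s\<^sup>2 / (r\<^sup>2 + s\<^sup>2)\<close> has a simple pole
  in \<open>r\<^sup>2\<close>.\<close>

lemma K2_independent:
  fixes S :: "real set" and d :: "real \<Rightarrow> real"
  assumes S: "finite S" "\<And>s. s \<in> S \<Longrightarrow> 0 < s" and "0 < a" "a < b"
    and zero: "\<And>r. a \<le> r \<Longrightarrow> r \<le> b \<Longrightarrow> (\<Sum>s\<in>S. d s * K2 r s) = 0"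
    and "s \<in> S"
  shows "d s = 0"
proof -
  have "(\<Sum>s\<in>S. - (d s * s * s) / (r\<^sup>2 + s\<^sup>2) ^ 1) = 0" if r: "a < r" "r < b" for r
  proof -
    have "(\<Sum>s\<in>S. d s * s * arctan (s / r)) = 2 * r ^ 3 * (\<Sum>s\<in>S. d s * K2 r s)"
      if "0 < r" for r
      using that by (simp add: K2_def sum_distrib_left mult.assoc)
    then have 0: "(\<Sum>s\<in>S. d s * s * arctan (s / r)) = 0" if "r \<in> {a<..<b}" for r
      using zero[of r] that \<open>0 < a\<close> by auto
    have "((\<lambda>r. \<Sum>s\<in>S. d s * s * arctan (s / r)) has_real_derivative
        (\<Sum>s\<in>S. - (d s * s * s) / (r\<^sup>2 + s\<^sup>2) ^ 1)) (at r)"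
      using r \<open>0 < a\<close> sum_power2_nonzero[of r]
      by (auto intro!: derivative_eq_intros sum.cong simp: divide_simps)
        (auto simp: algebra_simps power2_eq_square)
    moreover have "((\<lambda>r. \<Sum>s\<in>S. d s * s * arctan (s / r)) has_real_derivative 0) (at r)"
      by (rule has_field_derivative_transform_within_open[where f = "\<lambda>_. 0" and S = "{a<..<b}"])
        (use r 0 in auto)
    ultimately show ?thesis
      by (rule DERIV_unique)
  qed
  then have "- (d s * s * s) = 0"
    by (rule partial_fractions_independent[where a = a and b = b and k = 1, rotated 5])
       (use assms in auto)
  then show ?thesis
    using S(2)[OF \<open>s \<in> S\<close>] by simp
qed

text \<open>After multiplication by \<open>2 * r ^ 3\<close>, the two parts of \<open>K1\<close>
  combine under differentiation in \<open>r\<close> to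
  \<open>- 2 * r\<^sup>2 * s / (r\<^sup>2 + s\<^sup>2)\<^sup>2\<close>. The common factor
  \<open>- 2 * r\<^sup>2\<close> cancels and double poles remain.\<close>

lemma K1_independent:
  fixes S :: "real set" and d :: "real \<Rightarrow> real"
  assumes S: "finite S" "\<And>s. s \<in> S \<Longrightarrow> 0 < s" and "0 < a" "a < b"
    and zero: "\<And>r. a \<le> r \<Longrightarrow> r \<le> b \<Longrightarrow> (\<Sum>s\<in>S. d s * K1 r s) = 0"
    and "s \<in> S"
  shows "d s = 0"
proof -
  have "(\<Sum>s\<in>S. (d s * s) / (r\<^sup>2 + s\<^sup>2)\<^sup>2) = 0" if r: "a < r" "r < b" for r
  proof -
    have "(\<Sum>s\<in>S. d s * (arctan (s / r) + r * s / (r\<^sup>2 + s\<^sup>2))) = 2 * r ^ 3 * (\<Sum>s\<in>S. d s * K1 r s)"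
      if "0 < r" for r
      using that by (simp add: K1_def sum_distrib_left)
    then have 0: "(\<Sum>s\<in>S. d s * (arctan (s / r) + r * s / (r\<^sup>2 + s\<^sup>2))) = 0" if "r \<in> {a<..<b}" for r
      using zero[of r] that \<open>0 < a\<close> by auto
    have "((\<lambda>r. arctan (s / r) + r * s / (r\<^sup>2 + s\<^sup>2)) has_real_derivative
        - 2 * r\<^sup>2 * s / (r\<^sup>2 + s\<^sup>2)\<^sup>2) (at r)" for s
    proof -
      have "r \<noteq> 0" and q: "r\<^sup>2 + s\<^sup>2 \<noteq> 0"
        using r \<open>0 < a\<close> sum_power2_nonzero[of r s] by auto
      have "((\<lambda>r. arctan (s / r)) has_real_derivative - s / (r\<^sup>2 + s\<^sup>2)) (at r)"
        using \<open>r \<noteq> 0\<close> q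
        by (auto intro!: derivative_eq_intros simp: divide_simps) (simp add: algebra_simps power2_eq_square)
      moreover have "((\<lambda>r. r * s / (r\<^sup>2 + s\<^sup>2)) has_real_derivative
          s * (s\<^sup>2 - r\<^sup>2) / (r\<^sup>2 + s\<^sup>2)\<^sup>2) (at r)"
        by (rule derivative_eq_intros refl q)+ (simp add: algebra_simps power2_eq_square)
      ultimately have "((\<lambda>r. arctan (s / r) + r * s / (r\<^sup>2 + s\<^sup>2)) has_real_derivative
          - s / (r\<^sup>2 + s\<^sup>2) + s * (s\<^sup>2 - r\<^sup>2) / (r\<^sup>2 + s\<^sup>2)\<^sup>2) (at r)"
        by (rule DERIV_add)
      also have "- s / (r\<^sup>2 + s\<^sup>2) = - s * (r\<^sup>2 + s\<^sup>2) / (r\<^sup>2 + s\<^sup>2)\<^sup>2"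
        using q by (simp add: power2_eq_square[of "r\<^sup>2 + s\<^sup>2"])
      also have "- s * (r\<^sup>2 + s\<^sup>2) / (r\<^sup>2 + s\<^sup>2)\<^sup>2 + s * (s\<^sup>2 - r\<^sup>2) / (r\<^sup>2 + s\<^sup>2)\<^sup>2
          = - 2 * r\<^sup>2 * s / (r\<^sup>2 + s\<^sup>2)\<^sup>2"
        unfolding add_divide_distrib[symmetric] by (simp add: algebra_simps)
      finally show ?thesis .
    qed
    then have "((\<lambda>r. \<Sum>s\<in>S. d s * (arctan (s / r) + r * s / (r\<^sup>2 + s\<^sup>2))) has_real_derivative
        (\<Sum>s\<in>S. d s * (- 2 * r\<^sup>2 * s / (r\<^sup>2 + s\<^sup>2)\<^sup>2))) (at r)"
      by (intro DERIV_sum DERIV_cmult)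
    moreover have "((\<lambda>r. \<Sum>s\<in>S. d s * (arctan (s / r) + r * s / (r\<^sup>2 + s\<^sup>2))) has_real_derivative 0) (at r)"
      by (rule has_field_derivative_transform_within_open[where f = "\<lambda>_. 0" and S = "{a<..<b}"])
        (use r 0 in auto)
    ultimately have "(\<Sum>s\<in>S. d s * (- 2 * r\<^sup>2 * s / (r\<^sup>2 + s\<^sup>2)\<^sup>2)) = 0"
      by (rule DERIV_unique)
    also have "(\<Sum>s\<in>S. d s * (- 2 * r\<^sup>2 * s / (r\<^sup>2 + s\<^sup>2)\<^sup>2))
        = - 2 * r\<^sup>2 * (\<Sum>s\<in>S. (d s * s) / (r\<^sup>2 + s\<^sup>2)\<^sup>2)"
      unfolding sum_distrib_left by (intro sum.cong) auto
    finally show ?thesis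
      using r \<open>0 < a\<close> by simp
  qed
  then have "d s * s = 0"
    by (rule partial_fractions_independent[where a = a and b = b and k = 2, rotated 5])
       (use assms in auto)
  then show ?thesis
    using S(2)[OF \<open>s \<in> S\<close>] by simp
qed

text \<open>
  The nodes \<open>g i\<close> may coincide (as \<open>\<theta> ! i + \<theta> ! j\<close> does), so independence applies only after
  collecting equal nodes; the conclusion avoids mentioning the collected coefficients.
\<close>

lemma sum_functional_zero:
  fixes g :: "'a \<Rightarrow> real" and w :: "'a \<Rightarrow> real" and \<phi> :: "'b \<Rightarrow> real \<Rightarrow> real"
  assumes indep: "\<And>d. (\<And>r. r \<in> R \<Longrightarrow> (\<Sum>s\<in>g ` A. d s * \<phi> r s) = 0) \<Longrightarrow> \<forall>s\<in>g ` A. d s = 0"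
    and A: "finite A"
    and zero: "\<And>r. r \<in> R \<Longrightarrow> (\<Sum>i\<in>A. w i * \<phi> r (g i)) = 0"
  shows "(\<Sum>i\<in>A. w i * f (g i)) = 0"
proof -
  define d where "d s = (\<Sum>i | i \<in> A \<and> g i = s. w i)" for s
  have group: "(\<Sum>i\<in>A. w i * F (g i)) = (\<Sum>s\<in>g ` A. d s * F s)" for F :: "real \<Rightarrow> real"
    by (subst sum.image_gen[OF A, of _ g]) (auto simp: d_def sum_distrib_right intro!: sum.cong)
  have "\<forall>s\<in>g ` A. d s = 0"
    using zero group by (intro indep) auto
  then show ?thesis
    unfolding group by (intro sum.neutral) auto
qed

section \<open>Endpoints and \<open>G\<close>\<close>

text \<open>Positions start at 0, so the odd ones hold right endpoints; the signs are those of
  \<open>F b - F a\<close> in the fundamental theorem of calculus.\<close>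

definition endpoint_sign :: "nat \<Rightarrow> real" where
  "endpoint_sign i = (if odd i then 1 else - 1)"

lemma endpoint_sign_nonzero [simp]: "endpoint_sign i \<noteq> 0"
  by (simp add: endpoint_sign_def)

lemma sum_endpoint_sign:
  "(\<Sum>i<2 * m. endpoint_sign i * F (\<theta> ! i)) = (\<Sum>j<m. F (right_end \<theta> j) - F (left_end \<theta> j))"
  by (induction m) (simp_all add: endpoint_sign_def left_end_def right_end_def)

lemma endpoint_pos: "sorted_wrt (<) (0 # \<theta>) \<Longrightarrow> i < length \<theta> \<Longrightarrow> 0 < \<theta> ! i" for \<theta> :: "real list"
  by simp

lemma endpoint_less:
  "sorted_wrt (<) (0 # \<theta>) \<Longrightarrow> i < j \<Longrightarrow> j < length \<theta> \<Longrightarrow> \<theta> ! i < \<theta> ! j" for \<theta> :: "real list"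
  by (simp add: sorted_wrt_nth_less)

text \<open>The integral splits over disjoint intervals inside the positive half-line, and the
  fundamental theorem of calculus applies to each.\<close>

lemma set_lebesgue_integral_mu:
  assumes len: "length \<theta> = 2 * m" and sorted: "sorted_wrt (<) (0 # \<theta>)"
    and deriv: "\<And>x. 0 < x \<Longrightarrow> (F has_real_derivative f x) (at x)"
    and cont: "continuous_on {0<..} f"
  shows "(LINT x:{0<..}|mu m \<theta>. f x) = (\<Sum>i<2 * m. endpoint_sign i * F (\<theta> ! i))"
proof -
  let ?J = "\<lambda>j. {left_end \<theta> j..right_end \<theta> j}"
  have pos: "0 < left_end \<theta> j" if "j < m" for j
    using endpoint_pos[OF sorted, of "2 * j"] that len by (simp add: left_end_def)
  have le: "left_end \<theta> j \<le> right_end \<theta> j" if "j < m" for j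
    using endpoint_less[OF sorted, of "2 * j" "2 * j + 1"] that len
    by (simp add: left_end_def right_end_def)
  have gap: "right_end \<theta> i < left_end \<theta> j" if "i < j" "j < m" for i j
    using endpoint_less[OF sorted, of "2 * i + 1" "2 * j"] that len
    by (simp add: left_end_def right_end_def)
  have "?J i \<inter> ?J j = {}" if "i < m" "j < m" "i \<noteq> j" for i j
    using gap[of i j] gap[of j i] that by (cases i j rule: linorder_cases) auto
  then have disj: "disjoint_family_on ?J {..<m}"
    by (auto simp: disjoint_family_on_def)
  have sub: "I_set m \<theta> \<subseteq> {0<..}"
    using pos by (force simp: I_set_def)
  have J_sub: "?J j \<subseteq> {0<..}" if "j < m" for j
    using pos[OF that] by auto
  have contJ: "continuous_on (?J j) f" if "j < m" for j
    using continuous_on_subset[OF cont J_sub[OF that]] .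
  have [measurable]: "I_set m \<theta> \<in> sets borel"
    unfolding I_set_def by auto
  \<comment> \<open>Continuity of \<open>f\<close> is given only on \<open>{0<..}\<close>;
    multiplying by the indicator of this set gives a function measurable on the whole line.\<close>
  have meas: "(\<lambda>x. indicator {0<..} x *\<^sub>R f x) \<in> borel_measurable borel"
    using cont by (intro borel_measurable_continuous_on_indicator) auto
  have "(LINT x:{0<..}|mu m \<theta>. f x)
      = (LINT x|density lborel (\<lambda>x. ennreal (indicator (I_set m \<theta>) x)). indicator {0<..} x *\<^sub>R f x)"
    by (simp add: mu_def set_lebesgue_integral_def ennreal_indicator)
  also have "\<dots> = (LINT x|lborel. indicator (I_set m \<theta>) x *\<^sub>R indicator {0<..} x *\<^sub>R f x)"
    using meas by (intro integral_density) auto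
  also have "\<dots> = (LINT x:(\<Union>j<m. ?J j)|lborel. f x)"
    unfolding set_lebesgue_integral_def I_set_def[symmetric]
    using sub by (intro Bochner_Integration.integral_cong) (auto simp: indicator_def)
  also have "\<dots> = (\<Sum>j<m. LINT x:?J j|lborel. f x)"
    using disj contJ
    by (intro set_integral_finite_Union) (auto intro: borel_integrable_atLeastAtMost')
  also have "\<dots> = (\<Sum>j<m. F (right_end \<theta> j) - F (left_end \<theta> j))"
  proof (intro sum.cong refl)
    fix j
    assume "j \<in> {..<m}"
    then have j: "j < m"
      by simp
    show "(LINT x:?J j|lborel. f x) = F (right_end \<theta> j) - F (left_end \<theta> j)"
      unfolding set_lebesgue_integral_def
    proof (rule integral_FTC_atLeastAtMost[OF le[OF j] _ contJ[OF j]])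
      fix x
      assume "left_end \<theta> j \<le> x"
      then show "(F has_vector_derivative f x) (at x within ?J j)"
        using deriv[of x] pos[OF j]
        by (auto simp: has_real_derivative_iff_has_vector_derivative[symmetric]
            intro: has_field_derivative_at_within)
    qed
  qed
  finally show ?thesis
    by (simp only: sum_endpoint_sign)
qed

lemma continuous_on_K1: "0 < r \<Longrightarrow> continuous_on S (K1 r)"
  by (meson DERIV_continuous_on K1_deriv has_field_derivative_at_within)

text \<open>The single integral formula is applied twice: \<open>K1 r (y + v)\<close> is an
  antiderivative in \<open>v\<close>, then \<open>K2 r (y + \<theta> ! j)\<close> is one in
  \<open>y\<close>.\<close>

lemma G_mu_eq:
  assumes len: "length \<theta> = 2 * m" and sorted: "sorted_wrt (<) (0 # \<theta>)" and r: "0 < r"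
  shows "G (mu m \<theta>) r
    = (\<Sum>i<2 * m. \<Sum>j<2 * m. endpoint_sign i * endpoint_sign j * K2 r (\<theta> ! i + \<theta> ! j))"
proof -
  have inner: "(LINT v:{0<..}|mu m \<theta>. 1 / (r\<^sup>2 + (y + v)\<^sup>2)\<^sup>2)
      = (\<Sum>j<2 * m. endpoint_sign j * K1 r (y + \<theta> ! j))" for y
  proof (rule set_lebesgue_integral_mu[OF len sorted])
    fix v :: real
    show "((\<lambda>v. K1 r (y + v)) has_real_derivative 1 / (r\<^sup>2 + (y + v)\<^sup>2)\<^sup>2) (at v)"
      using K1_deriv[OF r, of "y + v"] DERIV_shift[of "K1 r" _ v y] by (simp add: add.commute)
  qed (use r sum_power2_nonzero in \<open>auto intro!: continuous_intros\<close>)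
  have "G (mu m \<theta>) r = (LINT y:{0<..}|mu m \<theta>. \<Sum>j<2 * m. endpoint_sign j * K1 r (y + \<theta> ! j))"
    by (simp only: G_def inner)
  also have "\<dots> = (\<Sum>i<2 * m. endpoint_sign i * (\<Sum>j<2 * m. endpoint_sign j * K2 r (\<theta> ! i + \<theta> ! j)))"
  proof (rule set_lebesgue_integral_mu[OF len sorted])
    fix y :: real
    have "((\<lambda>y. K2 r (y + \<theta> ! j)) has_real_derivative K1 r (y + \<theta> ! j)) (at y)" for j
      using K2_deriv[OF r] DERIV_shift by blast
    then show "((\<lambda>y. \<Sum>j<2 * m. endpoint_sign j * K2 r (y + \<theta> ! j)) has_real_derivative
        (\<Sum>j<2 * m. endpoint_sign j * K1 r (y + \<theta> ! j))) (at y)"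
      by (intro DERIV_sum DERIV_cmult)
  qed (intro continuous_intros continuous_on_compose2[OF continuous_on_K1[OF r, of UNIV]], auto)
  finally show ?thesis
    by (simp add: sum_distrib_left mult.assoc)
qed

section \<open>Recovery of the endpoints from \<open>G\<close>\<close>

text \<open>Pairing the endpoints of each interval gives increments of an increasing exponential.
  Positivity later fixes the sign of a square root and allows a factor to be cancelled.\<close>

lemma sum_endpoint_exp_pos:
  assumes "length \<theta> = 2 * m" "sorted_wrt (<) (0 # \<theta>)" "1 \<le> m" "0 < t"
  shows "0 < (\<Sum>i<2 * m. endpoint_sign i * exp (t * \<theta> ! i))"
proof -
  have "0 < (\<Sum>j<m. exp (t * right_end \<theta> j) - exp (t * left_end \<theta> j))"
    using assms endpoint_less[OF assms(2), of "2 * _" "2 * _ + 1"]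
    by (intro sum_pos) (auto simp: left_end_def right_end_def lessThan_empty_iff)
  then show ?thesis
    by (simp add: sum_endpoint_sign[of "\<lambda>x. exp (t * x)"])
qed

text \<open>Passing from exponentials to arbitrary \<open>f\<close> admits the indicator of a point,
  which reads off one coefficient.\<close>

lemma exp_sum_functional_zero:
  fixes g :: "'a \<Rightarrow> real"
  assumes "finite A" and "\<And>n. (\<Sum>i\<in>A. w i * exp (real (Suc n) * g i)) = 0"
  shows "(\<Sum>i\<in>A. w i * f (g i)) = 0"
proof (rule sum_functional_zero[where g = g and w = w and f = f and R = UNIV
      and \<phi> = "\<lambda>n x. exp (real (Suc n) * x)"])
  fix d
  assume d: "\<And>n. n \<in> UNIV \<Longrightarrow> (\<Sum>x\<in>g ` A. d x * exp (real (Suc n) * x)) = 0"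
  show "\<forall>x\<in>g ` A. d x = 0"
    using exponentials_independent[OF finite_imageI[OF assms(1)] d[OF UNIV_I]] by blast
qed (rule assms)+

lemma sum_mult_of_bool_nth:
  assumes "distinct xs" "k < length xs"
  shows "(\<Sum>i<length xs. w i * of_bool (xs ! i = xs ! k)) = (w k :: real)"
proof -
  have "(\<Sum>i<length xs. w i * of_bool (xs ! i = xs ! k)) = (\<Sum>i<length xs. if i = k then w i else 0)"
    using assms by (intro sum.cong) (auto simp: nth_eq_iff_index_eq)
  then show ?thesis
    using assms by simp
qed

text \<open>At most one position contributes, and its sign is nonzero, so the sum detects membership
  whatever the position.\<close>

lemma mem_set_iff_endpoint_sum:
  assumes "distinct \<theta>"
  shows "x \<in> set \<theta> \<longleftrightarrow> (\<Sum>i<length \<theta>. endpoint_sign i * of_bool (\<theta> ! i = x)) \<noteq> 0"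
proof (cases "x \<in> set \<theta>")
  case True
  then obtain k where "k < length \<theta>" "\<theta> ! k = x"
    by (metis in_set_conv_nth)
  then show ?thesis
    using sum_mult_of_bool_nth[OF assms, of k endpoint_sign] True by simp
next
  case False
  then show ?thesis
    by (auto intro!: sum.neutral simp: in_set_conv_nth)
qed

text \<open>The lengths \<open>2 * m\<close> and \<open>2 * l\<close> are not compared beforehand:
  the argument shows that the endpoint sets agree, and a strictly increasing list is determined by
  its set.\<close>

lemma G_mu_determines_endpoints:
  assumes \<theta>: "length \<theta> = 2 * m" "sorted_wrt (<) (0 # \<theta>)" "1 \<le> m"
    and \<theta>': "length \<theta>' = 2 * l" "sorted_wrt (<) (0 # \<theta>')" "1 \<le> l"
    and "0 < a" "a < b"
    and eq: "\<And>r. a \<le> r \<Longrightarrow> r \<le> b \<Longrightarrow> G (mu m \<theta>) r = G (mu l \<theta>') r"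
  shows "m = l \<and> \<theta> = \<theta>'"
proof -
  let ?s = endpoint_sign
  \<comment> \<open>The disjoint sum indexes the terms of both double sums, the second with opposite
    sign, so that equality of the two values of \<open>G\<close> becomes one vanishing
    combination.\<close>
  let ?A = "{..<2 * m} \<times> {..<2 * m} <+> {..<2 * l} \<times> {..<2 * l}"
  define w where "w = case_sum (\<lambda>(i, j). ?s i * ?s j) (\<lambda>(i, j). - (?s i * ?s j))"
  define g where "g = case_sum (\<lambda>(i, j). \<theta> ! i + \<theta> ! j) (\<lambda>(i, j). \<theta>' ! i + \<theta>' ! j)"
  have sum_A: "(\<Sum>p\<in>?A. w p * f (g p))
      = (\<Sum>i<2 * m. \<Sum>j<2 * m. ?s i * ?s j * f (\<theta> ! i + \<theta> ! j))
      - (\<Sum>i<2 * l. \<Sum>j<2 * l. ?s i * ?s j * f (\<theta>' ! i + \<theta>' ! j))" for f :: "real \<Rightarrow> real"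
    by (subst sum.Plus)
      (auto simp: w_def g_def case_prod_unfold sum.cartesian_product sum_negf)
  have pos: "\<forall>p\<in>?A. 0 < g p"
    using endpoint_pos[OF \<theta>(2)] endpoint_pos[OF \<theta>'(2)] \<theta>(1) \<theta>'(1)
    by (auto simp: g_def intro!: add_pos_pos)
  have zero: "(\<Sum>p\<in>?A. w p * f (g p)) = 0" for f
  proof (rule sum_functional_zero[where g = g and w = w and f = f and \<phi> = K2 and R = "{a..b}"])
    fix r
    assume "r \<in> {a..b}"
    then show "(\<Sum>p\<in>?A. w p * K2 r (g p)) = 0"
      using eq[of r] \<open>0 < a\<close> unfolding sum_A
      by (simp add: G_mu_eq[OF \<theta>(1,2)] G_mu_eq[OF \<theta>'(1,2)])
  next
    fix d
    assume d: "\<And>r. r \<in> {a..b} \<Longrightarrow> (\<Sum>s\<in>g ` ?A. d s * K2 r s) = 0"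
    have "d s = 0" if "s \<in> g ` ?A" for s
      by (rule K2_independent[OF _ _ \<open>0 < a\<close> \<open>a < b\<close> _ that]) (use pos d in auto)
    then show "\<forall>s\<in>g ` ?A. d s = 0"
      by blast
  qed auto
  let ?B = "{..<2 * m} <+> {..<2 * l}"
  define w1 where "w1 = case_sum ?s (\<lambda>i. - ?s i)"
  define g1 where "g1 = case_sum (\<lambda>i. \<theta> ! i) (\<lambda>i. \<theta>' ! i)"
  have sum_B: "(\<Sum>p\<in>?B. w1 p * f (g1 p))
      = (\<Sum>i<2 * m. ?s i * f (\<theta> ! i)) - (\<Sum>i<2 * l. ?s i * f (\<theta>' ! i))" for f :: "real \<Rightarrow> real"
    by (subst sum.Plus) (auto simp: w1_def g1_def sum_negf)
  have "(\<Sum>i<2 * m. ?s i * exp (t * \<theta> ! i)) = (\<Sum>i<2 * l. ?s i * exp (t * \<theta>' ! i))"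
    if "0 < t" for t
  proof -
    \<comment> \<open>For an exponential the double sum is a square; both bases are positive, so
      equality of squares passes to the bases.\<close>
    have sq: "(\<Sum>i<k. \<Sum>j<k. ?s i * ?s j * exp (t * (xs ! i + xs ! j)))
        = (\<Sum>i<k. ?s i * exp (t * xs ! i))\<^sup>2" for k and xs :: "real list"
      unfolding power2_eq_square sum_product by (simp add: exp_add algebra_simps)
    have "(\<Sum>i<2 * m. ?s i * exp (t * \<theta> ! i))\<^sup>2 = (\<Sum>i<2 * l. ?s i * exp (t * \<theta>' ! i))\<^sup>2"
      using zero[of "\<lambda>s. exp (t * s)"] unfolding sum_A[of "\<lambda>s. exp (t * s)"] sq by simp
    then show ?thesis
      using sum_endpoint_exp_pos[OF \<theta> that] sum_endpoint_exp_pos[OF \<theta>' that]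
      by (simp add: power2_eq_iff_nonneg)
  qed
  then have "(\<Sum>p\<in>?B. w1 p * exp (real (Suc n) * g1 p)) = 0" for n
    unfolding sum_B[of "\<lambda>x. exp (real (Suc n) * x)"] by simp
  then have "(\<Sum>p\<in>?B. w1 p * f (g1 p)) = 0" for f
    by (rule exp_sum_functional_zero[of ?B w1 g1, rotated]) simp
  then have eq1: "(\<Sum>i<2 * m. ?s i * f (\<theta> ! i)) = (\<Sum>i<2 * l. ?s i * f (\<theta>' ! i))" for f
    unfolding sum_B by simp
  have strict: "sorted_wrt (<) \<theta>" "sorted_wrt (<) \<theta>'"
    using \<theta>(2) \<theta>'(2) by simp_all
  \<comment> \<open>Testing with the indicator of \<open>x\<close> compares membership in the two
    lists.\<close>
  have "x \<in> set \<theta> \<longleftrightarrow> x \<in> set \<theta>'" for x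
    using mem_set_iff_endpoint_sum[of \<theta> x] mem_set_iff_endpoint_sum[of \<theta>' x] strict
      eq1[of "\<lambda>y. of_bool (y = x)"]
    by (simp add: strict_sorted_iff \<theta>(1) \<theta>'(1))
  then have "set \<theta> = set \<theta>'"
    by blast
  then have "\<theta> = \<theta>'"
    using strict by (simp add: strict_sorted_equal)
  then show ?thesis
    using \<theta>(1) \<theta>'(1) by simp
qed

text \<open>Since \<open>K1\<close> is the derivative of \<open>K2\<close>, the hypothesis says that
  the derivative of the double sum in \<open>G_mu_eq\<close> with respect to the endpoints vanishes
  in the direction \<open>h\<close>.\<close>

lemma G_mu_derivative_injective:
  assumes \<theta>: "length \<theta> = 2 * m" "sorted_wrt (<) (0 # \<theta>)" "1 \<le> m"
    and "0 < a" "a < b"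
    and deriv: "\<And>r. a \<le> r \<Longrightarrow> r \<le> b \<Longrightarrow> (\<Sum>i<2 * m. \<Sum>j<2 * m.
      endpoint_sign i * endpoint_sign j * (K1 r (\<theta> ! i + \<theta> ! j) * (h i + h j))) = 0"
    and "k < 2 * m"
  shows "h k = 0"
proof -
  let ?s = endpoint_sign
  let ?A = "{..<2 * m} \<times> {..<2 * m}"
  define w where "w = (\<lambda>(i, j). ?s i * ?s j * (h i + h j))"
  define g where "g = (\<lambda>(i, j). \<theta> ! i + \<theta> ! j)"
  have sum_A: "(\<Sum>p\<in>?A. w p * f (g p))
      = (\<Sum>i<2 * m. \<Sum>j<2 * m. ?s i * ?s j * (f (\<theta> ! i + \<theta> ! j) * (h i + h j)))"
    for f :: "real \<Rightarrow> real"
    by (auto simp: w_def g_def case_prod_unfold sum.cartesian_product mult_ac)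
  have pos: "\<forall>p\<in>?A. 0 < g p"
    using endpoint_pos[OF \<theta>(2)] \<theta>(1) by (auto simp: g_def intro!: add_pos_pos)
  have zero: "(\<Sum>p\<in>?A. w p * f (g p)) = 0" for f
  proof (rule sum_functional_zero[where g = g and w = w and f = f and \<phi> = K1 and R = "{a..b}"])
    fix r
    assume "r \<in> {a..b}"
    then show "(\<Sum>p\<in>?A. w p * K1 r (g p)) = 0"
      using deriv[of r] unfolding sum_A by simp
  next
    fix d
    assume d: "\<And>r. r \<in> {a..b} \<Longrightarrow> (\<Sum>s\<in>g ` ?A. d s * K1 r s) = 0"
    have "d s = 0" if "s \<in> g ` ?A" for s
      by (rule K1_independent[OF _ _ \<open>0 < a\<close> \<open>a < b\<close> _ that]) (use pos d in auto)
    then show "\<forall>s\<in>g ` ?A. d s = 0"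
      by blast
  qed auto
  have "(\<Sum>i<2 * m. ?s i * h i * exp (t * \<theta> ! i)) = 0" if "0 < t" for t
  proof -
    let ?e = "\<lambda>i. exp (t * \<theta> ! i)"
    have "0 = (\<Sum>i<2 * m. \<Sum>j<2 * m. ?s i * ?s j * (exp (t * (\<theta> ! i + \<theta> ! j)) * (h i + h j)))"
      using zero[of "\<lambda>s. exp (t * s)"] unfolding sum_A[of "\<lambda>s. exp (t * s)"] by simp
    \<comment> \<open>Splitting \<open>h i + h j\<close> gives two sums that agree after exchanging
      \<open>i\<close> and \<open>j\<close>; each is the wanted sum times the positive exponential
      sum.\<close>
    also have "\<dots> = (\<Sum>i<2 * m. \<Sum>j<2 * m. (?s i * h i * ?e i) * (?s j * ?e j))
        + (\<Sum>i<2 * m. \<Sum>j<2 * m. (?s i * ?e i) * (?s j * h j * ?e j))"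
      by (simp add: sum.distrib[symmetric] exp_add algebra_simps)
    also have "\<dots> = 2 * (\<Sum>i<2 * m. ?s i * h i * ?e i) * (\<Sum>j<2 * m. ?s j * ?e j)"
      unfolding sum_product[symmetric] by simp
    finally show ?thesis
      using sum_endpoint_exp_pos[OF \<theta> that] by simp
  qed
  then have "(\<Sum>i<2 * m. ?s i * h i * f (\<theta> ! i)) = 0" for f
    by (rule exp_sum_functional_zero[of "{..<2 * m}" "\<lambda>i. ?s i * h i" "(!) \<theta>", rotated]) simp_all
  \<comment> \<open>The indicator of \<open>\<theta> ! k\<close> isolates the term of
    \<open>k\<close> because the endpoints are distinct.\<close>
  from this[of "\<lambda>y. of_bool (y = \<theta> ! k)"] have "?s k * h k = 0"
    using sum_mult_of_bool_nth[of \<theta> k "\<lambda>i. ?s i * h i"] \<theta> \<open>k < 2 * m\<close>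
    by (simp add: strict_sorted_iff)
  then show ?thesis
    by simp
qed

section \<open>Compactness\<close>

text \<open>Interval lengths and gaps merge into one condition on neighbouring entries, and
  positivity of \<open>\<alpha>\<close> and \<open>\<delta>\<close> implies the strict chain. Only
  non-strict inequalities remain, so membership passes to coordinatewise limits.\<close>

lemma Theta_iff:
  assumes "0 < \<alpha>" "0 < \<delta>" "1 \<le> m"
  shows "\<theta> \<in> Theta m \<alpha> \<beta> \<delta> \<longleftrightarrow> length \<theta> = 2 * m \<and> \<alpha> \<le> \<theta> ! 0 \<and> \<theta> ! (2 * m - 1) \<le> \<beta> \<and>
    (\<forall>i. Suc i < 2 * m \<longrightarrow> \<delta> \<le> \<theta> ! Suc i - \<theta> ! i)"
proof -
  have last: "right_end \<theta> (m - 1) = \<theta> ! (2 * m - 1)"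
    using assms by (cases m) (simp_all add: right_end_def)
  have first: "left_end \<theta> 0 = \<theta> ! 0"
    by (simp add: left_end_def)
  have gaps: "(\<forall>j<m. \<delta> \<le> right_end \<theta> j - left_end \<theta> j) \<and>
      (\<forall>j. Suc j < m \<longrightarrow> \<delta> \<le> left_end \<theta> (Suc j) - right_end \<theta> j) \<longleftrightarrow>
      (\<forall>i. Suc i < 2 * m \<longrightarrow> \<delta> \<le> \<theta> ! Suc i - \<theta> ! i)" (is "?L \<longleftrightarrow> ?R")
  proof
    assume ?L
    show ?R
    proof (intro allI impI)
      fix i
      assume i: "Suc i < 2 * m"
      show "\<delta> \<le> \<theta> ! Suc i - \<theta> ! i"
      proof (cases "even i")
        case True
        then obtain j where "i = 2 * j"
          by blast
        with i \<open>?L\<close> show ?thesis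
          by (auto simp: left_end_def right_end_def)
      next
        case False
        then obtain j where "i = 2 * j + 1"
          by (blast elim: oddE)
        with i \<open>?L\<close> show ?thesis
          by (auto simp: left_end_def right_end_def)
      qed
    qed
  next
    assume R: ?R
    have "\<delta> \<le> right_end \<theta> j - left_end \<theta> j" if "j < m" for j
      using R[rule_format, of "2 * j"] that by (simp add: left_end_def right_end_def)
    moreover have "\<delta> \<le> left_end \<theta> (Suc j) - right_end \<theta> j" if "Suc j < m" for j
      using R[rule_format, of "2 * j + 1"] that by (simp add: left_end_def right_end_def)
    ultimately show ?L
      by blast
  qed
  have sorted: "sorted_wrt (<) (0 # \<theta>)"
    if "length \<theta> = 2 * m" "\<alpha> \<le> \<theta> ! 0" "\<forall>i. Suc i < 2 * m \<longrightarrow> \<delta> \<le> \<theta> ! Suc i - \<theta> ! i"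
  proof -
    have "(0 # \<theta>) ! i < (0 # \<theta>) ! Suc i" if "Suc i < length (0 # \<theta>)" for i
    proof (cases i)
      case 0
      then show ?thesis
        using \<open>\<alpha> \<le> \<theta> ! 0\<close> \<open>0 < \<alpha>\<close> by simp
    next
      case (Suc k)
      then have "\<delta> \<le> \<theta> ! Suc k - \<theta> ! k"
        using \<open>length \<theta> = 2 * m\<close> that \<open>\<forall>i. _ i\<close> by simp
      then show ?thesis
        using Suc \<open>0 < \<delta>\<close> by simp
    qed
    then show ?thesis
      by (subst sorted_wrt_iff_nth_Suc_transp) auto
  qed
  show ?thesis
    unfolding Theta_def mem_Collect_eq first last using gaps sorted by blast
qed

lemma ThetaD:
  assumes "\<theta> \<in> Theta m \<alpha> \<beta> \<delta>"
  shows "length \<theta> = 2 * m" and "sorted_wrt (<) (0 # \<theta>)"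
  using assms by (simp_all add: Theta_def)

lemma Theta_bounds:
  assumes "\<theta> \<in> Theta m \<alpha> \<beta> \<delta>" "i < 2 * m"
  shows "\<alpha> \<le> \<theta> ! i" and "\<theta> ! i \<le> \<beta>"
proof -
  have mono: "\<theta> ! j \<le> \<theta> ! k" if "j \<le> k" "k < 2 * m" for j k
    using endpoint_less[OF ThetaD(2)[OF assms(1)], of j k] that ThetaD(1)[OF assms(1)]
    by (cases "j = k") auto
  have "\<alpha> \<le> \<theta> ! 0" "\<theta> ! (2 * (m - 1) + 1) \<le> \<beta>"
    using assms(1) by (simp_all add: Theta_def left_end_def right_end_def)
  moreover have "i \<le> 2 * (m - 1) + 1" "2 * (m - 1) + 1 < 2 * m"
    using \<open>i < 2 * m\<close> by auto
  ultimately show "\<alpha> \<le> \<theta> ! i" "\<theta> ! i \<le> \<beta>"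
    using mono[of 0 i] mono[of i "2 * (m - 1) + 1"] \<open>i < 2 * m\<close> by linarith+
qed

text \<open>The lower bound for the infimum in \<open>set_mdist\<close> requires nonempty
  sets.\<close>

lemma Theta_nonempty:
  assumes "0 < \<alpha>" "0 < \<delta>" "m \<in> admissible M \<alpha> \<beta> \<delta>"
  shows "Theta m \<alpha> \<beta> \<delta> \<noteq> {}"
proof -
  have m: "1 \<le> m" "(2 * real m - 1) * \<delta> \<le> \<beta> - \<alpha>"
    using assms(3) by (auto simp: admissible_def)
  \<comment> \<open>With spacing \<open>\<delta>\<close> starting at \<open>\<alpha>\<close>, the
    last entry is \<open>\<alpha> + (2 * m - 1) * \<delta>\<close>, which admissibility bounds by
    \<open>\<beta>\<close>.\<close>
  have "map (\<lambda>i. \<alpha> + real i * \<delta>) [0..<2 * m] \<in> Theta m \<alpha> \<beta> \<delta>"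
    using m by (subst Theta_iff[OF assms(1,2) m(1)]) (auto simp: of_nat_diff algebra_simps)
  then show ?thesis
    by blast
qed

text \<open>Bolzano-Weierstrass for one coordinate at a time, with a further subsequence at each
  step; parameters are lists, so compactness is handled by coordinates.\<close>

lemma finite_family_convergent_subsequence:
  fixes X :: "'a \<Rightarrow> nat \<Rightarrow> real"
  assumes "finite I" "\<And>i. i \<in> I \<Longrightarrow> bounded (range (X i))"
  obtains s L where "strict_mono (s :: nat \<Rightarrow> nat)" "\<And>i. i \<in> I \<Longrightarrow> (\<lambda>k. X i (s k)) \<longlonglongrightarrow> L i"
proof -
  have "\<exists>s L. strict_mono (s :: nat \<Rightarrow> nat) \<and> (\<forall>i\<in>I. (\<lambda>k. X i (s k)) \<longlonglongrightarrow> L i)"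
    using assms
  proof (induction I rule: finite_induct)
    case empty
    then show ?case
      using strict_mono_id by blast
  next
    case (insert a I)
    then obtain s L where s: "strict_mono (s :: nat \<Rightarrow> nat)" "\<forall>i\<in>I. (\<lambda>k. X i (s k)) \<longlonglongrightarrow> L i"
      by blast
    have "bounded (range (X a \<circ> s))"
      using insert.prems[of a] by (rule bounded_subset) auto
    then obtain l t where t: "strict_mono t" "((X a \<circ> s) \<circ> t) \<longlonglongrightarrow> l"
      using bounded_imp_convergent_subsequence by blast
    have "(\<lambda>k. X i ((s \<circ> t) k)) \<longlonglongrightarrow> (L(a := l)) i" if "i \<in> insert a I" for i
    proof (cases "i = a")
      case True
      then show ?thesis
        using t(2) by (simp add: o_def)
    next
      case False
      then show ?thesis
        using LIMSEQ_subseq_LIMSEQ[OF s(2)[rule_format, of i] t(1)] that by (simp add: o_def)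
    qed
    then show ?case
      using strict_mono_o[OF s(1) t(1)] by blast
  qed
  then show ?thesis
    using that by blast
qed

lemma Theta_convergent_subsequence:
  assumes "0 < \<alpha>" "0 < \<delta>" "1 \<le> m" and X: "\<And>k. X k \<in> Theta m \<alpha> \<beta> \<delta>"
  obtains s \<theta> where "strict_mono (s :: nat \<Rightarrow> nat)" "\<theta> \<in> Theta m \<alpha> \<beta> \<delta>"
    "\<And>i. i < 2 * m \<Longrightarrow> (\<lambda>k. X (s k) ! i) \<longlonglongrightarrow> \<theta> ! i"
proof -
  have "bounded (range (\<lambda>k. X k ! i))" if "i < 2 * m" for i
    using Theta_bounds[OF X that]
    by (intro bounded_subset[OF bounded_closed_interval[of \<alpha> \<beta>]]) auto
  then obtain s L where s: "strict_mono (s :: nat \<Rightarrow> nat)"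
    and L: "\<And>i. i \<in> {..<2 * m} \<Longrightarrow> (\<lambda>k. X (s k) ! i) \<longlonglongrightarrow> L i"
    using finite_family_convergent_subsequence[of "{..<2 * m}" "\<lambda>i k. X k ! i"] by auto
  define \<theta> where "\<theta> = map L [0..<2 * m]"
  have \<theta>: "\<theta> ! i = L i" if "i < 2 * m" for i
    using that by (simp add: \<theta>_def)
  note iff = Theta_iff[OF assms(1-3)]
  have "\<alpha> \<le> L 0"
    using X assms(3) by (intro LIMSEQ_le_const[OF L]) (auto simp: iff)
  moreover have "L (2 * m - 1) \<le> \<beta>"
    using X assms(3) by (intro LIMSEQ_le_const2[OF L]) (auto simp: iff)
  moreover have "\<delta> \<le> L (Suc i) - L i" if "Suc i < 2 * m" for i
    using X that by (intro LIMSEQ_le_const[OF tendsto_diff[OF L L]]) (auto simp: iff)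
  ultimately have "\<theta> \<in> Theta m \<alpha> \<beta> \<delta>"
    using assms(3) by (auto simp: iff \<theta>) (simp add: \<theta>_def)
  then show ?thesis
    using s L \<theta> by (intro that[of s \<theta>]) auto
qed

section \<open>Continuity of \<open>G\<close> in the endpoints and in \<open>r\<close>\<close>

lemma isCont_K2: "0 < r \<Longrightarrow> isCont (K2 r) s"
  using K2_deriv DERIV_isCont by blast

lemma isCont_K1: "0 < r \<Longrightarrow> isCont (K1 r) s"
  using K1_deriv DERIV_isCont by blast

lemma tendsto_G_mu:
  assumes X: "\<And>k. X k \<in> Theta m \<alpha> \<beta> \<delta>" and \<theta>: "\<theta> \<in> Theta m \<alpha> \<beta> \<delta>" and r: "0 < r"
    and lim: "\<And>i. i < 2 * m \<Longrightarrow> (\<lambda>k. X k ! i) \<longlonglongrightarrow> \<theta> ! i"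
  shows "(\<lambda>k. G (mu m (X k)) r) \<longlonglongrightarrow> G (mu m \<theta>) r"
  unfolding G_mu_eq[OF ThetaD[OF X] r] G_mu_eq[OF ThetaD[OF \<theta>] r]
  by (intro tendsto_sum tendsto_mult_left isCont_tendsto_compose[OF isCont_K2[OF r]] tendsto_add lim)
    auto

lemma continuous_on_G_mu:
  assumes "\<theta> \<in> Theta m \<alpha> \<beta> \<delta>" and "S \<subseteq> {0<..}"
  shows "continuous_on S (G (mu m \<theta>))"
proof -
  have "continuous_on S (\<lambda>r. \<Sum>i<2 * m. \<Sum>j<2 * m.
      endpoint_sign i * endpoint_sign j * K2 r (\<theta> ! i + \<theta> ! j))"
    unfolding K2_def using assms(2) by (intro continuous_intros) auto
  then show ?thesis
    using G_mu_eq[OF ThetaD[OF assms(1)]] assms(2) by (subst continuous_on_cong[OF refl]) auto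
qed

text \<open>Continuity on a compact interval makes both restrictions points of
  \<open>C_space\<close>, so the supremum distance dominates pointwise differences. This is how that
  distance enters the limit arguments.\<close>

lemma abs_G_diff_le_mdist:
  assumes "0 < rm" "r \<in> {rm..rp}" and \<theta>: "\<theta> \<in> Theta m \<alpha> \<beta> \<delta>" "\<theta>' \<in> Theta l \<alpha> \<beta> \<delta>"
  shows "\<bar>G (mu m \<theta>) r - G (mu l \<theta>') r\<bar> \<le> mdist (C_space rm rp) (G_map rm rp m \<theta>) (G_map rm rp l \<theta>')"
proof -
  have sub: "{rm..rp} \<subseteq> {0<..}"
    using \<open>0 < rm\<close> by auto
  have mem: "G_map rm rp k \<eta> \<in> mspace (C_space rm rp)" if "\<eta> \<in> Theta k \<alpha> \<beta> \<delta>" for k \<eta>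
  proof -
    have "continuous_on {rm..rp} (G_map rm rp k \<eta>)"
      unfolding G_map_def using continuous_on_G_mu[OF that, of "{rm..rp}"] sub
      by (subst continuous_on_cong[OF refl, where g = "G (mu k \<eta>)"]) auto
    then show ?thesis
      by (subst compactin_mspace_cfunspace) (auto simp: G_map_def)
  qed
  have "mdist euclidean_metric (G_map rm rp m \<theta> r) (G_map rm rp l \<theta>' r)
      \<le> mdist (C_space rm rp) (G_map rm rp m \<theta>) (G_map rm rp l \<theta>')"
    using assms(2) by (intro mdist_cfunspace_imp_mdist_le[OF mem[OF \<theta>(1)] mem[OF \<theta>(2)]]) auto
  then show ?thesis
    using assms(2) by (simp add: G_map_def dist_real_def)
qed

section \<open>Separation and inverse Lipschitz bound by compactness\<close>

text \<open>The values of \<open>G\<close> at the two limit parameters agree on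
  \<open>{rm..rp}\<close> because the distances tend to 0, and injectivity identifies these
  parameters.\<close>

lemma Theta_pair_convergent_subsequence:
  assumes "0 < \<alpha>" "0 < \<delta>" "0 < rm" "rm < rp" "1 \<le> m" "1 \<le> l"
    and X: "\<And>k. X k \<in> Theta m \<alpha> \<beta> \<delta>" and Y: "\<And>k. Y k \<in> Theta l \<alpha> \<beta> \<delta>"
    and lim: "(\<lambda>k. mdist (C_space rm rp) (G_map rm rp m (X k)) (G_map rm rp l (Y k))) \<longlonglongrightarrow> 0"
  obtains s \<theta> where "m = l" "strict_mono (s :: nat \<Rightarrow> nat)" "\<theta> \<in> Theta m \<alpha> \<beta> \<delta>"
    "\<And>i. i < 2 * m \<Longrightarrow> (\<lambda>k. X (s k) ! i) \<longlonglongrightarrow> \<theta> ! i"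
    "\<And>i. i < 2 * m \<Longrightarrow> (\<lambda>k. Y (s k) ! i) \<longlonglongrightarrow> \<theta> ! i"
proof -
  obtain s \<theta> where s: "strict_mono (s :: nat \<Rightarrow> nat)" "\<theta> \<in> Theta m \<alpha> \<beta> \<delta>"
    and Xs: "\<And>i. i < 2 * m \<Longrightarrow> (\<lambda>k. X (s k) ! i) \<longlonglongrightarrow> \<theta> ! i"
    using Theta_convergent_subsequence[OF assms(1,2,5), of X] X by blast
  \<comment> \<open>The second subsequence is taken inside the first, so both sequences converge
    along \<open>s \<circ> t\<close>.\<close>
  obtain t \<eta> where t: "strict_mono (t :: nat \<Rightarrow> nat)" "\<eta> \<in> Theta l \<alpha> \<beta> \<delta>"
    and Yt: "\<And>i. i < 2 * l \<Longrightarrow> (\<lambda>k. Y (s (t k)) ! i) \<longlonglongrightarrow> \<eta> ! i"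
    using Theta_convergent_subsequence[OF assms(1,2,6), of "\<lambda>k. Y (s k)"] Y by blast
  have Xt: "(\<lambda>k. X (s (t k)) ! i) \<longlonglongrightarrow> \<theta> ! i" if "i < 2 * m" for i
    using LIMSEQ_subseq_LIMSEQ[OF Xs[OF that] t(1)] by (simp add: o_def)
  have st: "strict_mono (\<lambda>k. s (t k))"
    using strict_mono_o[OF s(1) t(1)] by (simp add: o_def)
  have "G (mu m \<theta>) r = G (mu l \<eta>) r" if r: "rm \<le> r" "r \<le> rp" for r
  proof -
    let ?D = "\<lambda>k. G (mu m (X (s (t k)))) r - G (mu l (Y (s (t k)))) r"
    have "?D \<longlonglongrightarrow> 0"
    proof (rule Lim_null_comparison)
      show "\<forall>\<^sub>F k in sequentially. norm (?D k) \<le>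
          mdist (C_space rm rp) (G_map rm rp m (X (s (t k)))) (G_map rm rp l (Y (s (t k))))"
        using abs_G_diff_le_mdist[OF \<open>0 < rm\<close> _ X Y] r by auto
      show "(\<lambda>k. mdist (C_space rm rp) (G_map rm rp m (X (s (t k)))) (G_map rm rp l (Y (s (t k))))) \<longlonglongrightarrow> 0"
        using LIMSEQ_subseq_LIMSEQ[OF lim st] by (simp add: o_def)
    qed
    moreover have "?D \<longlonglongrightarrow> G (mu m \<theta>) r - G (mu l \<eta>) r"
      using r \<open>0 < rm\<close> by (intro tendsto_diff tendsto_G_mu[OF X s(2)] tendsto_G_mu[OF Y t(2)] Xt Yt) auto
    ultimately have "G (mu m \<theta>) r - G (mu l \<eta>) r = 0"
      using LIMSEQ_unique by blast
    then show ?thesis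
      by simp
  qed
  then have "m = l \<and> \<theta> = \<eta>"
    using G_mu_determines_endpoints[OF ThetaD[OF s(2)] \<open>1 \<le> m\<close> ThetaD[OF t(2)] \<open>1 \<le> l\<close> \<open>0 < rm\<close> \<open>rm < rp\<close>]
    by blast
  then show ?thesis
    using that[OF _ st s(2) Xt] Yt by blast
qed

text \<open>Distances arbitrarily close to 0 would force \<open>m = l\<close>. The condition
  \<open>m \<noteq> l\<close> sits inside the existential so that a positive constant can be chosen
  for every pair.\<close>

lemma Theta_separation:
  assumes "0 < \<alpha>" "0 < \<delta>" "0 < rm" "rm < rp" "1 \<le> m" "1 \<le> l"
  shows "\<exists>\<epsilon>>0. m \<noteq> l \<longrightarrow> (\<forall>\<theta>\<in>Theta m \<alpha> \<beta> \<delta>. \<forall>\<theta>'\<in>Theta l \<alpha> \<beta> \<delta>.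
    \<epsilon> \<le> mdist (C_space rm rp) (G_map rm rp m \<theta>) (G_map rm rp l \<theta>'))"
proof (rule ccontr)
  assume contra: "\<not> ?thesis"
  let ?d = "\<lambda>\<theta> \<theta>'. mdist (C_space rm rp) (G_map rm rp m \<theta>) (G_map rm rp l \<theta>')"
  \<comment> \<open>For \<open>m = l\<close> the implication is void and
    \<open>\<epsilon> = 1\<close> would be a witness.\<close>
  have "m \<noteq> l"
    using contra zero_less_one[where 'a = real] by blast
  have "\<exists>\<theta> \<theta>'. \<theta> \<in> Theta m \<alpha> \<beta> \<delta> \<and> \<theta>' \<in> Theta l \<alpha> \<beta> \<delta> \<and> ?d \<theta> \<theta>' < 1 / real (Suc n)" for n
  proof -
    have "0 < 1 / real (Suc n)"
      by simp
    with contra show ?thesis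
      by (meson not_le)
  qed
  then obtain X Y where X: "\<And>n. X n \<in> Theta m \<alpha> \<beta> \<delta>" and Y: "\<And>n. Y n \<in> Theta l \<alpha> \<beta> \<delta>"
    and d: "\<And>n. ?d (X n) (Y n) < 1 / real (Suc n)"
    by metis
  have "(\<lambda>n. ?d (X n) (Y n)) \<longlonglongrightarrow> 0"
    using less_imp_le[OF d]
    by (intro Lim_null_comparison[OF _ LIMSEQ_Suc[OF lim_1_over_n]]) (simp del: of_nat_Suc)
  then have "m = l"
    by (rule Theta_pair_convergent_subsequence[OF assms X Y])
  with \<open>m \<noteq> l\<close> show False ..
qed

text \<open>
  Both endpoints of the quotient move, so this is differentiability in the strict sense.
\<close>

lemma difference_quotient_tendsto:
  fixes F F' :: "real \<Rightarrow> real"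
  assumes deriv: "\<And>x. (F has_real_derivative F' x) (at x)" and cont: "isCont F' c"
    and u: "u \<longlonglongrightarrow> c" and v: "v \<longlonglongrightarrow> c"
    and quot: "(\<lambda>k. (u k - v k) / N k) \<longlonglongrightarrow> \<eta>"
  shows "(\<lambda>k. (F (u k) - F (v k)) / N k) \<longlonglongrightarrow> F' c * \<eta>"
proof -
  have mvt: "\<exists>z. \<bar>z - c\<bar> \<le> \<bar>x - c\<bar> + \<bar>y - c\<bar> \<and> F x - F y = F' z * (x - y)" for x y
  proof (cases x y rule: linorder_cases)
    case less
    then obtain z where "x < z" "z < y" "F y - F x = (y - x) * F' z"
      using MVT2[of x y F F'] deriv by blast
    then show ?thesis
      by (intro exI[of _ z]) (auto simp: algebra_simps abs_if)
  next
    case equal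
    then show ?thesis
      by (intro exI[of _ x]) auto
  next
    case greater
    then obtain z where "y < z" "z < x" "F x - F y = (x - y) * F' z"
      using MVT2[of y x F F'] deriv by blast
    then show ?thesis
      by (intro exI[of _ z]) (auto simp: algebra_simps abs_if)
  qed
  have "\<forall>k. \<exists>z. \<bar>z - c\<bar> \<le> \<bar>u k - c\<bar> + \<bar>v k - c\<bar> \<and> F (u k) - F (v k) = F' z * (u k - v k)"
    using mvt by blast
  from choice[OF this] obtain z where z: "\<And>k. \<bar>z k - c\<bar> \<le> \<bar>u k - c\<bar> + \<bar>v k - c\<bar>"
    "\<And>k. F (u k) - F (v k) = F' (z k) * (u k - v k)"
    by blast
  have "(\<lambda>k. \<bar>u k - c\<bar> + \<bar>v k - c\<bar>) \<longlonglongrightarrow> 0"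
    using tendsto_add[OF tendsto_rabs_zero[OF LIM_zero[OF u]] tendsto_rabs_zero[OF LIM_zero[OF v]]]
    by simp
  then have "(\<lambda>k. z k - c) \<longlonglongrightarrow> 0"
    by (rule Lim_null_comparison[rotated]) (use z(1) in simp)
  then have "(\<lambda>k. F' (z k)) \<longlonglongrightarrow> F' c"
    using isCont_tendsto_compose[OF cont] LIM_zero_cancel by blast
  then have "(\<lambda>k. F' (z k) * ((u k - v k) / N k)) \<longlonglongrightarrow> F' c * \<eta>"
    using quot by (rule tendsto_mult)
  then show ?thesis
    by (simp add: z(2))
qed

text \<open>If every constant failed, normalised parameter differences would accumulate at a unit
  vector annihilated by the derivative, contradicting
  \<open>G_mu_derivative_injective\<close>.\<close>

lemma Theta_inverse_Lipschitz:
  assumes "0 < \<alpha>" "0 < \<delta>" "0 < rm" "rm < rp" "1 \<le> m"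
  shows "\<exists>C>0. \<forall>\<theta>\<in>Theta m \<alpha> \<beta> \<delta>. \<forall>\<theta>'\<in>Theta m \<alpha> \<beta> \<delta>.
    euclid_dist (2 * m) \<theta> \<theta>' \<le> C * mdist (C_space rm rp) (G_map rm rp m \<theta>) (G_map rm rp m \<theta>')"
proof (rule ccontr)
  assume contra: "\<not> ?thesis"
  let ?d = "\<lambda>\<theta> \<theta>'. mdist (C_space rm rp) (G_map rm rp m \<theta>) (G_map rm rp m \<theta>')"
  have "\<exists>\<theta> \<theta>'. \<theta> \<in> Theta m \<alpha> \<beta> \<delta> \<and> \<theta>' \<in> Theta m \<alpha> \<beta> \<delta> \<and>
      real (Suc n) * ?d \<theta> \<theta>' < euclid_dist (2 * m) \<theta> \<theta>'" for n
  proof -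
    have "0 < real (Suc n)"
      by simp
    with contra show ?thesis
      by (meson not_le)
  qed
  then obtain X Y where X: "\<And>n. X n \<in> Theta m \<alpha> \<beta> \<delta>" and Y: "\<And>n. Y n \<in> Theta m \<alpha> \<beta> \<delta>"
    and d: "\<And>n. real (Suc n) * ?d (X n) (Y n) < euclid_dist (2 * m) (X n) (Y n)"
    by metis
  define N where "N n = euclid_dist (2 * m) (X n) (Y n)" for n
  have d_nonneg: "0 \<le> ?d (X n) (Y n)" for n
    using abs_G_diff_le_mdist[OF \<open>0 < rm\<close> _ X Y, of rm rp n n] \<open>rm < rp\<close> by fastforce
  \<comment> \<open>Strict failure of the bound with constant \<open>Suc n\<close> makes
    \<open>N n\<close> positive, so division by it is legitimate.\<close>
  have N_pos: "0 < N n" for n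
    using d[of n] d_nonneg[of n] by (smt (verit) N_def mult_nonneg_nonneg of_nat_0_le_iff)
  have d_le: "?d (X n) (Y n) / N n \<le> 1 / real (Suc n)" for n
    using d[of n] N_pos[of n] by (simp add: divide_simps N_def algebra_simps)
  \<comment> \<open>This uniform bound turns convergence of \<open>?d (X n) (Y n) / N n\<close> to 0
    into convergence of the distances themselves.\<close>
  have N_le: "N n \<le> 2 * real m * (\<beta> - \<alpha>)" for n
  proof -
    have "N n \<le> (\<Sum>i<2 * m. \<bar>X n ! i - Y n ! i\<bar>)"
      unfolding N_def euclid_dist_def by (rule L2_set_le_sum_abs)
    also have "\<dots> \<le> (\<Sum>i<2 * m. \<beta> - \<alpha>)"
      using Theta_bounds[OF X[of n]] Theta_bounds[OF Y[of n]]
      by (intro sum_mono) (smt (verit) lessThan_iff)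
    finally show ?thesis
      by simp
  qed
  have inv_lim: "(\<lambda>n. 1 / real (Suc n)) \<longlonglongrightarrow> 0"
    by (rule LIMSEQ_Suc[OF lim_1_over_n])
  have "(\<lambda>n. ?d (X n) (Y n)) \<longlonglongrightarrow> 0"
  proof (rule Lim_null_comparison)
    have "?d (X n) (Y n) \<le> 2 * real m * (\<beta> - \<alpha>) * (1 / real (Suc n))" for n
    proof -
      have "?d (X n) (Y n) = N n * (?d (X n) (Y n) / N n)"
        using N_pos[of n] by simp
      also have "\<dots> \<le> 2 * real m * (\<beta> - \<alpha>) * (1 / real (Suc n))"
        using N_le[of n] d_le[of n] N_pos[of n] d_nonneg[of n]
        by (intro mult_mono) auto
      finally show ?thesis .
    qed
    then show "\<forall>\<^sub>F n in sequentially. norm (?d (X n) (Y n)) \<le> 2 * real m * (\<beta> - \<alpha>) * (1 / real (Suc n))"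
      using d_nonneg by simp
    show "(\<lambda>n. 2 * real m * (\<beta> - \<alpha>) * (1 / real (Suc n))) \<longlonglongrightarrow> 0"
      by (rule tendsto_mult_right_zero[OF inv_lim])
  qed
  then obtain s \<theta> where s: "strict_mono (s :: nat \<Rightarrow> nat)" and \<theta>: "\<theta> \<in> Theta m \<alpha> \<beta> \<delta>"
    and Xs: "\<And>i. i < 2 * m \<Longrightarrow> (\<lambda>k. X (s k) ! i) \<longlonglongrightarrow> \<theta> ! i"
    and Ys: "\<And>i. i < 2 * m \<Longrightarrow> (\<lambda>k. Y (s k) ! i) \<longlonglongrightarrow> \<theta> ! i"
    by (rule Theta_pair_convergent_subsequence[OF assms assms(5) X Y]) blast
  \<comment> \<open>These are the coordinates of a Euclidean unit vector, the direction from
    \<open>Y (s k)\<close> to \<open>X (s k)\<close>.\<close>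
  define h where "h i k = (X (s k) ! i - Y (s k) ! i) / N (s k)" for i k
  have h_sum: "(\<Sum>i<2 * m. (h i k)\<^sup>2) = 1" for k
  proof -
    have "(\<Sum>i<2 * m. (X (s k) ! i - Y (s k) ! i)\<^sup>2) = (N (s k))\<^sup>2"
      unfolding N_def euclid_dist_def L2_set_def by (simp add: sum_nonneg)
    then show ?thesis
      using N_pos[of "s k"] by (simp add: h_def power_divide sum_divide_distrib[symmetric])
  qed
  have "bounded (range (h i))" if "i < 2 * m" for i
  proof -
    have "(h i k)\<^sup>2 \<le> 1" for k
      using member_le_sum[of i "{..<2 * m}" "\<lambda>i. (h i k)\<^sup>2"] that by (simp add: h_sum)
    then have "\<bar>h i k\<bar> \<le> 1" for k
      by (simp add: abs_square_le_1)
    then show ?thesis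
      unfolding bounded_iff by auto
  qed
  then obtain t H where t: "strict_mono (t :: nat \<Rightarrow> nat)"
    and H: "\<And>i. i < 2 * m \<Longrightarrow> (\<lambda>k. h i (t k)) \<longlonglongrightarrow> H i"
    using finite_family_convergent_subsequence[of "{..<2 * m}" h] by auto
  have "(\<lambda>k. \<Sum>i<2 * m. (h i (t k))\<^sup>2) \<longlonglongrightarrow> (\<Sum>i<2 * m. (H i)\<^sup>2)"
    by (intro tendsto_sum tendsto_power H) auto
  then have H_sum: "(\<Sum>i<2 * m. (H i)\<^sup>2) = 1"
    by (simp add: h_sum LIMSEQ_const_iff)
  let ?x = "\<lambda>k. X (s (t k))" and ?y = "\<lambda>k. Y (s (t k))" and ?N = "\<lambda>k. N (s (t k))"
  have xt: "(\<lambda>k. ?x k ! i) \<longlonglongrightarrow> \<theta> ! i" and yt: "(\<lambda>k. ?y k ! i) \<longlonglongrightarrow> \<theta> ! i" if "i < 2 * m" for i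
    using LIMSEQ_subseq_LIMSEQ[OF Xs[OF that] t] LIMSEQ_subseq_LIMSEQ[OF Ys[OF that] t]
    by (simp_all add: o_def)
  have st: "strict_mono (\<lambda>k. s (t k))"
    using strict_mono_o[OF s t] by (simp add: o_def)
  \<comment> \<open>The difference quotients of \<open>G\<close> tend to 0 by \<open>d_le\<close>
    and, by strict differentiability of \<open>K2 r\<close>, to this double sum.\<close>
  have "(\<Sum>i<2 * m. \<Sum>j<2 * m.
      endpoint_sign i * endpoint_sign j * (K1 r (\<theta> ! i + \<theta> ! j) * (H i + H j))) = 0"
    if r: "rm \<le> r" "r \<le> rp" for r
  proof -
    have "0 < r"
      using r \<open>0 < rm\<close> by simp
    let ?Q = "\<lambda>k. (G (mu m (?x k)) r - G (mu m (?y k)) r) / ?N k"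
    have Q_lim: "?Q \<longlonglongrightarrow> 0"
    proof (rule Lim_null_comparison)
      have "norm (?Q k) \<le> 1 / real (Suc (s (t k)))" for k
      proof -
        have "norm (?Q k) \<le> ?d (?x k) (?y k) / ?N k"
          using abs_G_diff_le_mdist[OF \<open>0 < rm\<close> _ X Y, of r rp "s (t k)" "s (t k)"] r N_pos[of "s (t k)"]
          by (simp add: divide_right_mono)
        then show ?thesis
          using d_le[of "s (t k)"] by linarith
      qed
      then show "\<forall>\<^sub>F k in sequentially. norm (?Q k) \<le> 1 / real (Suc (s (t k)))"
        by simp
      show "(\<lambda>k. 1 / real (Suc (s (t k)))) \<longlonglongrightarrow> 0"
        using LIMSEQ_subseq_LIMSEQ[OF inv_lim st] by (simp add: o_def)
    qed
    have Q_eq: "?Q = (\<lambda>k. \<Sum>i<2 * m. \<Sum>j<2 * m. endpoint_sign i * endpoint_sign j *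
        ((K2 r (?x k ! i + ?x k ! j) - K2 r (?y k ! i + ?y k ! j)) / ?N k))"
      unfolding G_mu_eq[OF ThetaD[OF X] \<open>0 < r\<close>] G_mu_eq[OF ThetaD[OF Y] \<open>0 < r\<close>]
      by (simp add: sum_subtractf[symmetric] sum_divide_distrib right_diff_distrib diff_divide_distrib)
    have "(\<lambda>k. \<Sum>i<2 * m. \<Sum>j<2 * m. endpoint_sign i * endpoint_sign j *
        ((K2 r (?x k ! i + ?x k ! j) - K2 r (?y k ! i + ?y k ! j)) / ?N k)) \<longlonglongrightarrow>
        (\<Sum>i<2 * m. \<Sum>j<2 * m. endpoint_sign i * endpoint_sign j *
          (K1 r (\<theta> ! i + \<theta> ! j) * (H i + H j)))"
    proof (intro tendsto_sum tendsto_mult_left)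
      fix i j
      assume "i \<in> {..<2 * m}" "j \<in> {..<2 * m}"
      then have ij: "i < 2 * m" "j < 2 * m"
        by auto
      have "(\<lambda>k. (?x k ! i + ?x k ! j - (?y k ! i + ?y k ! j)) / ?N k) \<longlonglongrightarrow> H i + H j"
        using tendsto_add[OF H[OF ij(1)] H[OF ij(2)]]
        by (simp add: h_def add_divide_distrib[symmetric] algebra_simps)
      with K2_deriv[OF \<open>0 < r\<close>] isCont_K1[OF \<open>0 < r\<close>]
        tendsto_add[OF xt[OF ij(1)] xt[OF ij(2)]] tendsto_add[OF yt[OF ij(1)] yt[OF ij(2)]]
      show "(\<lambda>k. (K2 r (?x k ! i + ?x k ! j) - K2 r (?y k ! i + ?y k ! j)) / ?N k) \<longlonglongrightarrow>
          K1 r (\<theta> ! i + \<theta> ! j) * (H i + H j)"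
        by (rule difference_quotient_tendsto)
    qed
    from this Q_lim[unfolded Q_eq] show ?thesis
      by (rule LIMSEQ_unique)
  qed
  then have "H i = 0" if "i < 2 * m" for i
    by (rule G_mu_derivative_injective[OF ThetaD[OF \<theta>] \<open>1 \<le> m\<close> \<open>0 < rm\<close> \<open>rm < rp\<close> _ that])
  then show False
    using H_sum by simp
qed

section \<open>Uniform constants over the finitely many admissible interval counts\<close>

theorem corollary4p6:
  fixes \<alpha> \<beta> \<delta> rm rp :: real and M :: nat
  assumes "0 < \<alpha>" and "\<alpha> < \<beta>" and "0 < \<delta>" and "0 < rm" and "rm < rp" and "1 \<le> M"
    and "admissible M \<alpha> \<beta> \<delta> \<noteq> {}"
  shows
    "(\<forall>m\<in>admissible M \<alpha> \<beta> \<delta>. \<forall>l\<in>admissible M \<alpha> \<beta> \<delta>. m \<noteq> l \<longrightarrow>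
        set_mdist (C_space rm rp)
          (G_map rm rp m ` Theta m \<alpha> \<beta> \<delta>) (G_map rm rp l ` Theta l \<alpha> \<beta> \<delta>) > 0) \<and>
     (\<exists>\<epsilon>>0. \<exists>C>0. \<forall>m\<in>admissible M \<alpha> \<beta> \<delta>. \<forall>l\<in>admissible M \<alpha> \<beta> \<delta>.
        \<forall>\<theta>\<in>Theta m \<alpha> \<beta> \<delta>. \<forall>\<theta>'\<in>Theta l \<alpha> \<beta> \<delta>.
          mdist (C_space rm rp) (G_map rm rp m \<theta>) (G_map rm rp l \<theta>') < \<epsilon> \<longrightarrow>
            m = l \<and>
            euclid_dist (2 * m) \<theta> \<theta>' \<le>
              C * mdist (C_space rm rp) (G_map rm rp m \<theta>) (G_map rm rp m \<theta>')) \<and>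
     inj_on (\<lambda>(m, \<theta>). G_map rm rp m \<theta>) (SIGMA m:admissible M \<alpha> \<beta> \<delta>. Theta m \<alpha> \<beta> \<delta>)"
proof (intro conjI)
  let ?A = "admissible M \<alpha> \<beta> \<delta>"
  let ?d = "\<lambda>m l \<theta> \<theta>'. mdist (C_space rm rp) (G_map rm rp m \<theta>) (G_map rm rp l \<theta>')"
  have fin: "finite ?A"
    by (rule finite_subset[of _ "{..M}"]) (auto simp: admissible_def)
  have ge1: "1 \<le> m" if "m \<in> ?A" for m
    using that by (simp add: admissible_def)
  have "\<exists>\<epsilon>>0. m \<noteq> l \<longrightarrow> (\<forall>\<theta>\<in>Theta m \<alpha> \<beta> \<delta>. \<forall>\<theta>'\<in>Theta l \<alpha> \<beta> \<delta>. \<epsilon> \<le> ?d m l \<theta> \<theta>')"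
    if "m \<in> ?A" "l \<in> ?A" for m l
    using Theta_separation[OF assms(1,3,4,5) ge1 ge1] that by blast
  then obtain e where e_pos: "\<And>m l. m \<in> ?A \<Longrightarrow> l \<in> ?A \<Longrightarrow> 0 < (e m l :: real)"
    and e: "\<And>m l \<theta> \<theta>'. m \<in> ?A \<Longrightarrow> l \<in> ?A \<Longrightarrow> m \<noteq> l \<Longrightarrow> \<theta> \<in> Theta m \<alpha> \<beta> \<delta> \<Longrightarrow>
      \<theta>' \<in> Theta l \<alpha> \<beta> \<delta> \<Longrightarrow> e m l \<le> ?d m l \<theta> \<theta>'"
    by metis
  have "\<exists>C>0. \<forall>\<theta>\<in>Theta m \<alpha> \<beta> \<delta>. \<forall>\<theta>'\<in>Theta m \<alpha> \<beta> \<delta>. euclid_dist (2 * m) \<theta> \<theta>' \<le> C * ?d m m \<theta> \<theta>'"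
    if "m \<in> ?A" for m
    using Theta_inverse_Lipschitz[OF assms(1,3,4,5) ge1[OF that]] .
  then obtain c where c_pos: "\<And>m. m \<in> ?A \<Longrightarrow> 0 < (c m :: real)"
    and c: "\<And>m \<theta> \<theta>'. m \<in> ?A \<Longrightarrow> \<theta> \<in> Theta m \<alpha> \<beta> \<delta> \<Longrightarrow> \<theta>' \<in> Theta m \<alpha> \<beta> \<delta> \<Longrightarrow>
      euclid_dist (2 * m) \<theta> \<theta>' \<le> c m * ?d m m \<theta> \<theta>'"
    by metis
  show "\<forall>m\<in>?A. \<forall>l\<in>?A. m \<noteq> l \<longrightarrow> set_mdist (C_space rm rp)
      (G_map rm rp m ` Theta m \<alpha> \<beta> \<delta>) (G_map rm rp l ` Theta l \<alpha> \<beta> \<delta>) > 0"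
  proof (intro ballI impI)
    fix m l
    assume *: "m \<in> ?A" "l \<in> ?A" "m \<noteq> l"
    have "e m l \<le> set_mdist (C_space rm rp)
        (G_map rm rp m ` Theta m \<alpha> \<beta> \<delta>) (G_map rm rp l ` Theta l \<alpha> \<beta> \<delta>)"
      unfolding set_mdist_def
      using Theta_nonempty[OF assms(1,3) *(1)] Theta_nonempty[OF assms(1,3) *(2)] e[OF *]
      by (intro cINF_greatest) auto
    with e_pos[OF *(1,2)] show "0 < set_mdist (C_space rm rp)
        (G_map rm rp m ` Theta m \<alpha> \<beta> \<delta>) (G_map rm rp l ` Theta l \<alpha> \<beta> \<delta>)"
      by linarith
  qed
  \<comment> \<open>Admissible counts form a finite nonempty set, so both extrema exist. The minimum
    includes pairs with \<open>m = l\<close>, for which \<open>e m l\<close> is positive as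
    well.\<close>
  define \<epsilon> where "\<epsilon> = Min ((\<lambda>(m, l). e m l) ` (?A \<times> ?A))"
  define C where "C = Max (c ` ?A)"
  have "0 < \<epsilon>"
    unfolding \<epsilon>_def using fin assms(7) e_pos by (subst Min_gr_iff) auto
  moreover have "0 < C"
    unfolding C_def using fin assms(7) c_pos by (subst Max_gr_iff) auto
  moreover have "m = l \<and> euclid_dist (2 * m) \<theta> \<theta>' \<le> C * ?d m m \<theta> \<theta>'"
    if "m \<in> ?A" "l \<in> ?A" "\<theta> \<in> Theta m \<alpha> \<beta> \<delta>" "\<theta>' \<in> Theta l \<alpha> \<beta> \<delta>" "?d m l \<theta> \<theta>' < \<epsilon>" for m l \<theta> \<theta>'
  proof -
    have "\<epsilon> \<le> e m l"
      unfolding \<epsilon>_def using fin that by (intro Min_le) auto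
    then have "m = l"
      using e[OF that(1,2) _ that(3,4)] that(5) by fastforce
    moreover have "0 \<le> ?d m m \<theta> \<theta>'"
      using abs_G_diff_le_mdist[OF \<open>0 < rm\<close>, of rm rp \<theta> m \<alpha> \<beta> \<delta> \<theta>' m] that \<open>m = l\<close> \<open>rm < rp\<close>
      by auto
    moreover have "c m \<le> C"
      unfolding C_def using fin that by (intro Max_ge) auto
    ultimately show ?thesis
      using c[of m \<theta> \<theta>'] that by (meson mult_right_mono order_trans)
  qed
  ultimately show "\<exists>\<epsilon>>0. \<exists>C>0. \<forall>m\<in>?A. \<forall>l\<in>?A. \<forall>\<theta>\<in>Theta m \<alpha> \<beta> \<delta>. \<forall>\<theta>'\<in>Theta l \<alpha> \<beta> \<delta>.
      ?d m l \<theta> \<theta>' < \<epsilon> \<longrightarrow> m = l \<and> euclid_dist (2 * m) \<theta> \<theta>' \<le> C * ?d m m \<theta> \<theta>'"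
    by blast
  show "inj_on (\<lambda>(m, \<theta>). G_map rm rp m \<theta>) (SIGMA m:?A. Theta m \<alpha> \<beta> \<delta>)"
  proof (rule inj_onI, clarify)
    fix m l \<theta> \<theta>'
    assume m: "m \<in> ?A" "\<theta> \<in> Theta m \<alpha> \<beta> \<delta>" and l: "l \<in> ?A" "\<theta>' \<in> Theta l \<alpha> \<beta> \<delta>"
      and eq: "G_map rm rp m \<theta> = G_map rm rp l \<theta>'"
    \<comment> \<open>Equality of the restrictions is pointwise equality on the interval, so
      injectivity follows directly from the recovery of the endpoints.\<close>
    have "G (mu m \<theta>) r = G (mu l \<theta>') r" if "rm \<le> r" "r \<le> rp" for r
      using fun_cong[OF eq, of r] that by (simp add: G_map_def)
    then show "m = l \<and> \<theta> = \<theta>'"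
      by (rule G_mu_determines_endpoints[OF ThetaD[OF m(2)] ge1[OF m(1)] ThetaD[OF l(2)] ge1[OF l(1)]
            \<open>0 < rm\<close> \<open>rm < rp\<close>])
  qed
qed

end
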